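(* Let $X$ be a real Banach lattice with $\dim X\ge 2$. The following statements are equivalent: (i) $\lambda^+(X)=2$; (ii) $\beta(X)=2$; (iii) $X$ is an abstract $L$-space.
   Context: For a Banach lattice $X$, $S_X^+$ denotes the set of elements $x\in X$ with $x\ge 0$ and $\|x\|=1$. The lattice Schäffer constant is $\lambda^+(X)=\inf\{\max\{\|x-y\|,\|x+y\|\} : x,y\in S_X^+\}$. For $\dim X\ge2$, $\beta(X)=\inf\{\|x\vee y\| : x,y\in S_X^+,\ x\wedge y=0\}$. A Banach lattice $X$ is an abstract $L$-space if $\|x+y\|=\|x\|+\|y\|$ for all disjoint $x,y\in X$ (i.e. $|x|\wedge|y|=0$). *)

theory Defs
  imports "HOL-Analysis.Analysis" "HOL-Library.Lattice_Algebras"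
begin

text \<open>
  The class \<^class>\<open>lattice_ab_group_add_abs\<close> provides the modulus
  \<open>\<bar>x\<bar> = sup x (- x)\<close>; the lattice operations \<open>x \<or> y\<close> and \<open>x \<and> y\<close> of the
  Riesz space are \<open>sup x y\<close> and \<open>inf x y\<close>.
\<close>

class banach_lattice = banach + ordered_real_vector + lattice_ab_group_add_abs +
  assumes norm_mono_abs: "\<bar>x\<bar> \<le> \<bar>y\<bar> \<Longrightarrow> norm x \<le> norm y"

definition pos_sphere :: "'a::banach_lattice set" where
  "pos_sphere = {x. 0 \<le> x \<and> norm x = 1}"

text \<open>
  The two constants are attached to a space, i.e. to a type; both are infima of sets of
  reals bounded below by \<open>0\<close>. The set in \<open>lattice_schaffer\<close> is nonempty for every nonzero
  space, the one in \<open>lattice_beta\<close> for every space of dimension at least two, so that there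
  the real-valued \<open>Inf\<close> is the genuine infimum.
\<close>

definition lattice_schaffer :: "'a::banach_lattice itself \<Rightarrow> real" where
  "lattice_schaffer _ =
     Inf {max (norm (x - y)) (norm (x + y)) | x y :: 'a. x \<in> pos_sphere \<and> y \<in> pos_sphere}"

definition lattice_beta :: "'a::banach_lattice itself \<Rightarrow> real" where
  "lattice_beta _ =
     Inf {norm (sup x y) | x y :: 'a. x \<in> pos_sphere \<and> y \<in> pos_sphere \<and> inf x y = 0}"

definition abstract_L_space :: "'a::banach_lattice itself \<Rightarrow> bool" where
  "abstract_L_space _ \<longleftrightarrow>
     (\<forall>x y :: 'a. inf \<bar>x\<bar> \<bar>y\<bar> = 0 \<longrightarrow> norm (x + y) = norm x + norm y)"

text \<open>
  \<open>dim UNIV\<close> is a junk value in infinite dimensions, so that dimension at least two is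
  stated by a linearly independent set of two vectors.
\<close>

definition dim_ge_two :: "'a::real_vector itself \<Rightarrow> bool" where
  "dim_ge_two _ \<longleftrightarrow> (\<exists>B :: 'a set. card B = 2 \<and> independent B)"

end

theory Submission
  imports Defs
begin

text \<open>
  For nonnegative \<open>x\<close>, \<open>y\<close> one has \<open>\<bar>x - y\<bar> \<le> x + y\<close>, so the first constant is the
  infimum of \<open>norm (x + y)\<close> over all pairs in the positive sphere; for disjoint \<open>x\<close>, \<open>y\<close> one has
  \<open>sup x y = x + y\<close>, so the second is the infimum of the same quantity over the disjoint pairs.
  If either constant is \<open>2\<close>, then \<open>norm (x + y) \<ge> 2\<close> for disjoint unit vectors of the cone,
  and a scaling argument turns this into additivity of the norm on all disjoint pairs
  (\<open>abstract_L_space_if_pos_sphere\<close>).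

  The converse needs more than disjoint pairs: additivity of the norm on disjoint elements has to
  be extended to the whole positive cone (\<open>norm_add_nonneg\<close>). Let \<open>u = x + y\<close> and think of \<open>x\<close>
  and \<open>u\<close> as a function with values in \<open>[0, 1]\<close> and the constant \<open>1\<close>. The quantities
  \<open>F t = norm (pprt (x - t u))\<close> and \<open>G t = norm (pprt (t u - x))\<close> satisfy \<open>F 0 = norm x\<close>,
  \<open>G 1 = norm y\<close>, \<open>F 1 = G 0 = 0\<close>. At a level \<open>t\<close>, the decrease of \<open>F\<close> from \<open>t\<close> to \<open>t + h\<close>
  is at most the norm of an element carried by the region above \<open>t\<close>, and the increase of \<open>G\<close>
  from \<open>t - h\<close> to \<open>t\<close> is at most the norm of an element carried by the region below \<open>t\<close>. These
  elements are disjoint and both at most \<open>h u\<close>, so together the two changes are at most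
  \<open>h norm u\<close>. Summation over the levels \<open>0, 1/m, ..., 1\<close> telescopes to
  \<open>norm x + norm y \<le> (1 + 1/m) norm u\<close>, and \<open>m\<close> is arbitrary.

  The second constant equals \<open>2\<close> only if disjoint unit vectors exist at all. If there were none,
  the order would be total, and a totally ordered Banach lattice, being Archimedean, is at most
  one-dimensional (\<open>scaleR_if_total\<close>).
\<close>

section \<open>Positive parts and disjoint elements\<close>

lemma norm_mono_nonneg:
  fixes x y :: "'a::banach_lattice"
  assumes "0 \<le> x" "x \<le> y"
  shows "norm x \<le> norm y"
  using norm_mono_abs[of x y] assms by (simp add: order_trans[OF assms])

lemma norm_abs_eq:
  fixes x :: "'a::banach_lattice"
  shows "norm \<bar>x\<bar> = norm x"
  using norm_mono_abs[of x "\<bar>x\<bar>"] norm_mono_abs[of "\<bar>x\<bar>" x] by simp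

lemma sup_eq_add_if_disjoint:
  fixes x y :: "'a::banach_lattice"
  assumes "inf x y = 0"
  shows "sup x y = x + y"
  using add_eq_inf_sup[of x y] assms by simp

lemma norm_diff_le_norm_add:
  fixes x y :: "'a::banach_lattice"
  assumes "0 \<le> x" "0 \<le> y"
  shows "norm (x - y) \<le> norm (x + y)"
  using norm_mono_abs[of "x - y" "x + y"] abs_triangle_ineq4[of x y] assms by simp

lemma pprt_pprt_minus:
  fixes w u :: "'a::banach_lattice"
  assumes "0 \<le> u"
  shows "pprt (pprt w - u) = pprt (w - u)"
  using assms unfolding pprt_def
  by (simp add: diff_conv_add_uminus add_sup_distrib_right sup_assoc sup_absorb2 del: add_uminus_conv_diff)

text \<open>
  Cutting \<open>p\<close> at height \<open>u\<close>: the part below the cut and the excess.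
\<close>

lemma eq_inf_add_pprt_minus:
  fixes p u :: "'a::banach_lattice"
  shows "p = inf p u + pprt (p - u)"
proof -
  have "pprt (p - u) = sup p u - u"
    unfolding pprt_def by (simp add: diff_conv_add_uminus add_sup_distrib_right del: add_uminus_conv_diff)
  then have "inf p u + pprt (p - u) = (inf p u + sup p u) - u"
    by (simp only: add_diff_eq)
  also have "inf p u + sup p u = p + u"
    using add_eq_inf_sup[of p u] by (simp add: add.commute)
  finally show ?thesis by simp
qed

text \<open>
  Since \<open>pprt w = w + pprt (- w)\<close>, the infimum is that of \<open>w\<close> and \<open>0\<close> translated by
  \<open>pprt (- w)\<close>, and \<open>inf w 0\<close> is the negative of \<open>pprt (- w)\<close>.
\<close>

lemma inf_pprt_pprt_uminus:
  fixes w :: "'a::banach_lattice"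
  shows "inf (pprt w) (pprt (- w)) = 0"
proof -
  have "inf (pprt w) (pprt (- w)) = inf (w + pprt (- w)) (0 + pprt (- w))"
    unfolding pprt_def by (simp add: add_sup_distrib_left sup_commute)
  also have "\<dots> = inf w 0 + pprt (- w)"
    by (rule add_inf_distrib_right[symmetric])
  also have "\<dots> = 0"
    unfolding pprt_def using neg_inf_eq_sup[of w 0] by (simp add: eq_neg_iff_add_eq_0[symmetric])
  finally show ?thesis .
qed

section \<open>From disjoint pairs to the positive cone\<close>

text \<open>
  The bound for one level, scaled so that the distance to the next level is \<open>u\<close>. The cut-off
  pieces of \<open>pprt w\<close> and \<open>pprt (- w)\<close> at height \<open>u\<close> inherit disjointness from these parts, so
  their sum is their supremum and stays below \<open>u\<close>; what is cut off is \<open>pprt (w - u)\<close> and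
  \<open>pprt (- w - u)\<close>, the corresponding parts at the two neighbouring levels.
\<close>

lemma norm_parts_step:
  fixes w u :: "'a::banach_lattice"
  assumes L: "abstract_L_space TYPE('a)" and u: "0 \<le> u"
  shows "norm (pprt w) + norm (pprt (- w))
    \<le> norm u + norm (pprt (w - u)) + norm (pprt (- w - u))"
proof -
  let ?c = "inf (pprt w) u" and ?d = "inf (pprt (- w)) u"
  have nn: "0 \<le> ?c" "0 \<le> ?d"
    using u by (simp_all add: pprt_def)
  have "inf ?c ?d \<le> inf (pprt w) (pprt (- w))"
    by (meson inf_le1 inf_mono)
  then have dis: "inf ?c ?d = 0"
    using nn by (simp add: inf_pprt_pprt_uminus antisym)
  have "norm ?c + norm ?d = norm (?c + ?d)"
    using L dis nn unfolding abstract_L_space_def by simp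
  also have "\<dots> \<le> norm u"
    unfolding sup_eq_add_if_disjoint[OF dis, symmetric]
    using nn by (intro norm_mono_nonneg) (auto intro: le_supI1)
  finally have cd: "norm ?c + norm ?d \<le> norm u" .
  have split: "norm (pprt v) \<le> norm (inf (pprt v) u) + norm (pprt (v - u))" for v :: 'a
  proof -
    have "pprt v = inf (pprt v) u + pprt (v - u)"
      using eq_inf_add_pprt_minus[of "pprt v" u] by (simp only: pprt_pprt_minus[OF u])
    then show ?thesis
      using norm_triangle_ineq[of "inf (pprt v) u" "pprt (v - u)"] by metis
  qed
  show ?thesis
    using cd split[of w] split[of "- w"] by linarith
qed

text \<open>
  The levels of \<open>m x\<close> against \<open>0, u, ..., m u\<close> give a telescoping sum. There are \<open>m + 1\<close> levels
  but only \<open>m\<close> steps between them, whence a factor \<open>(m + 1) / m\<close> that disappears in the limit.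
\<close>

lemma norm_add_nonneg:
  fixes x y :: "'a::banach_lattice"
  assumes L: "abstract_L_space TYPE('a)" and x: "0 \<le> x" and y: "0 \<le> y"
  shows "norm (x + y) = norm x + norm y"
proof (rule antisym[OF norm_triangle_ineq])
  define u where "u = x + y"
  have u: "0 \<le> u" using x y by (simp add: u_def)
  have bound: "real m * (norm x + norm y) \<le> real (m + 1) * norm u" for m :: nat
  proof -
    define w where "w t = real m *\<^sub>R x - t *\<^sub>R u" for t :: real
    \<comment> \<open>The index of \<open>G\<close> is shifted by one, because at level \<open>k\<close> the sum compares \<open>F\<close> with level
      \<open>k + 1\<close> and \<open>G\<close> with level \<open>k - 1\<close>.\<close>
    define F where "F k = norm (pprt (w (real k)))" for k
    define G where "G k = norm (pprt (- w (real k - 1)))" for k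
    have "F k + G (Suc k) \<le> norm u + F (Suc k) + G k" for k
    proof -
      have "w (real k) - u = w (real (Suc k))" "- w (real k) - u = - w (real k - 1)"
        by (simp_all add: w_def algebra_simps)
      then show ?thesis
        using norm_parts_step[OF L u, of "w (real k)"] by (simp add: F_def G_def)
    qed
    then have step: "G (Suc k) - G k + (F k - F (Suc k)) \<le> norm u" for k
      by (smt (verit))
    have "(\<Sum>k<m + 1. G (Suc k) - G k) + (\<Sum>k<m + 1. F k - F (Suc k)) \<le> real (m + 1) * norm u"
      using sum_bounded_above[of "{..<m + 1}" "\<lambda>k. G (Suc k) - G k + (F k - F (Suc k))" "norm u"] step
      by (simp only: sum.distrib) simp
    then have "G (m + 1) - G 0 + (F 0 - F (m + 1)) \<le> real (m + 1) * norm u"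
      by (simp only: sum_lessThan_telescope sum_lessThan_telescope')
    moreover have "F 0 = real m * norm x"
      using x by (simp add: F_def w_def scaleR_nonneg_nonneg)
    moreover have "G 0 = 0"
    proof -
      have "0 \<le> w (- 1)"
        using x u by (simp add: w_def scaleR_nonneg_nonneg)
      then show ?thesis by (simp add: G_def)
    qed
    moreover have "G (m + 1) = real m * norm y"
    proof -
      have "- w (real m) = real m *\<^sub>R y"
        by (simp add: w_def u_def algebra_simps)
      then show ?thesis using y by (simp add: G_def scaleR_nonneg_nonneg)
    qed
    moreover have "F (m + 1) = 0"
    proof -
      have "w (real (m + 1)) = - (u + real m *\<^sub>R y)"
        by (simp add: w_def u_def algebra_simps)
      also have "\<dots> \<le> 0"
        unfolding neg_le_0_iff_le using u y by (intro add_nonneg_nonneg scaleR_nonneg_nonneg) auto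
      finally show ?thesis by (simp add: F_def)
    qed
    ultimately show ?thesis by (simp add: distrib_left)
  qed
  show "norm x + norm y \<le> norm (x + y)"
  proof (rule ccontr)
    assume "\<not> norm x + norm y \<le> norm (x + y)"
    then have "0 < norm x + norm y - norm u" by (simp add: u_def)
    then obtain m :: nat where "norm u < real m * (norm x + norm y - norm u)"
      using reals_Archimedean3 by blast
    with bound[of m] show False by (simp add: algebra_simps)
  qed
qed

section \<open>From the positive sphere to all disjoint pairs\<close>

text \<open>
  By the triangle inequality each of \<open>\<bar>x\<bar>\<close>, \<open>\<bar>y\<bar>\<close> exceeds \<open>\<bar>x + y\<bar>\<close> at most by the other,
  and trivially at most by itself, hence at most by their infimum, which is \<open>0\<close>; so their supremum, which is their sum, is at
  most \<open>\<bar>x + y\<bar>\<close>.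
\<close>

lemma abs_add_if_disjoint:
  fixes x y :: "'a::banach_lattice"
  assumes "inf \<bar>x\<bar> \<bar>y\<bar> = 0"
  shows "\<bar>x + y\<bar> = \<bar>x\<bar> + \<bar>y\<bar>"
proof (rule antisym[OF abs_triangle_ineq])
  have "sup \<bar>x\<bar> \<bar>y\<bar> \<le> \<bar>x + y\<bar> + inf \<bar>x\<bar> \<bar>y\<bar>"
  proof (rule le_supI)
    have "\<bar>x\<bar> \<le> \<bar>x + y\<bar> + \<bar>y\<bar>" "\<bar>y\<bar> \<le> \<bar>x + y\<bar> + \<bar>x\<bar>"
      using abs_triangle_ineq4[of "x + y" y] abs_triangle_ineq4[of "x + y" x] by simp_all
    then show "\<bar>x\<bar> \<le> \<bar>x + y\<bar> + inf \<bar>x\<bar> \<bar>y\<bar>" "\<bar>y\<bar> \<le> \<bar>x + y\<bar> + inf \<bar>x\<bar> \<bar>y\<bar>"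
      by (simp_all add: add_inf_distrib_left)
  qed
  then show "\<bar>x\<bar> + \<bar>y\<bar> \<le> \<bar>x + y\<bar>"
    using sup_eq_add_if_disjoint[OF assms] assms by simp
qed

lemma inf_scaleR_eq_0:
  fixes x y :: "'a::banach_lattice"
  assumes "inf x y = 0" "0 \<le> a" "0 \<le> b"
  shows "inf (a *\<^sub>R x) (b *\<^sub>R y) = 0"
proof (rule antisym)
  have x: "0 \<le> x" and y: "0 \<le> y"
    using assms(1) by (metis inf_le1, metis inf_le2)
  \<comment> \<open>A common factor dominating both, made positive so that it can be divided out.\<close>
  define c where "c = max a b + 1"
  have c: "0 < c" "a \<le> c" "b \<le> c" using assms by (auto simp: c_def)
  let ?z = "inf (a *\<^sub>R x) (b *\<^sub>R y)"
  have "?z \<le> c *\<^sub>R x" "?z \<le> c *\<^sub>R y"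
    using c x y by (meson inf_le1 inf_le2 order_trans scaleR_right_mono)+
  then have "(1 / c) *\<^sub>R ?z \<le> x" "(1 / c) *\<^sub>R ?z \<le> y"
    using c scaleR_left_mono[of ?z _ "1 / c"] by fastforce+
  then have "(1 / c) *\<^sub>R ?z \<le> 0"
    using assms(1) by (metis le_inf_iff)
  then show "?z \<le> 0"
    using c scaleR_left_mono[of "(1 / c) *\<^sub>R ?z" 0 c] by simp
  show "0 \<le> ?z" using x y assms by (simp add: scaleR_nonneg_nonneg)
qed

text \<open>
  If the unit vectors satisfy \<open>norm (x + y) \<ge> 2\<close>, the triangle inequality is sharp on the whole
  cone that they span: enlarging the smaller coefficient to the larger one, \<open>s\<close>, gives a vector of
  norm at least \<open>2 s\<close>, and costs at most the difference of the coefficients.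
\<close>

lemma norm_scaleR_add_ge:
  fixes x y :: "'a::real_normed_vector"
  assumes "norm x = 1" "norm y = 1" "2 \<le> norm (x + y)" "0 \<le> a" "0 \<le> b"
  shows "a + b \<le> norm (a *\<^sub>R x + b *\<^sub>R y)"
proof -
  have *: "s + t \<le> norm (s *\<^sub>R v + t *\<^sub>R w)"
    if "norm w = 1" "2 \<le> norm (v + w)" "0 \<le> t" "t \<le> s" for s t and v w :: 'a
  proof -
    have "s * 2 \<le> norm (s *\<^sub>R (v + w))"
      using that by (simp add: mult_left_mono)
    also have "\<dots> = norm ((s *\<^sub>R v + t *\<^sub>R w) + (s - t) *\<^sub>R w)"
      by (simp add: algebra_simps)
    also have "\<dots> \<le> norm (s *\<^sub>R v + t *\<^sub>R w) + (s - t)"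
      using that norm_triangle_ineq[of "s *\<^sub>R v + t *\<^sub>R w" "(s - t) *\<^sub>R w"] by simp
    finally show ?thesis by simp
  qed
  show ?thesis
    using *[of y x b a] *[of x y a b] assms by (cases "b \<le> a") (simp_all add: add.commute)
qed

lemma abstract_L_space_if_pos_sphere:
  assumes "\<And>x y :: 'a::banach_lattice. x \<in> pos_sphere \<Longrightarrow> y \<in> pos_sphere \<Longrightarrow> inf x y = 0
    \<Longrightarrow> 2 \<le> norm (x + y)"
  shows "abstract_L_space TYPE('a)"
  unfolding abstract_L_space_def
proof (intro allI impI)
  fix x y :: 'a
  assume d: "inf \<bar>x\<bar> \<bar>y\<bar> = 0"
  show "norm (x + y) = norm x + norm y"
  proof (cases "x = 0 \<or> y = 0")
    case False
    let ?n = "\<lambda>z. (1 / norm z) *\<^sub>R \<bar>z\<bar>"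
    have sph: "?n z \<in> pos_sphere" if "z \<noteq> 0" for z :: 'a
      using that by (simp add: pos_sphere_def norm_abs_eq scaleR_nonneg_nonneg)
    have "inf (?n x) (?n y) = 0"
      using d by (intro inf_scaleR_eq_0) auto
    then have "2 \<le> norm (?n x + ?n y)"
      using assms sph False by blast
    then have "norm x + norm y \<le> norm (norm x *\<^sub>R ?n x + norm y *\<^sub>R ?n y)"
      using False by (intro norm_scaleR_add_ge) (simp_all add: norm_abs_eq)
    also have "\<dots> = norm \<bar>x + y\<bar>"
      using False by (simp add: abs_add_if_disjoint[OF d])
    finally show ?thesis
      using norm_triangle_ineq[of x y] by (simp add: norm_abs_eq)
  qed auto
qed

section \<open>Existence of disjoint unit vectors\<close>

text \<open>
  As for the real numbers, \<open>y\<close> is \<open>T\<close> times \<open>e\<close> for the supremum \<open>T\<close> of all \<open>t\<close> with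
  \<open>t e \<le> y\<close>: both lie between \<open>(T - \<epsilon>) e\<close> and \<open>(T + \<epsilon>) e\<close> for every positive \<open>\<epsilon>\<close>. The Archimedean property enters through the monotone norm: \<open>b e \<le> y\<close> is
  impossible once \<open>b norm e\<close> exceeds \<open>norm y\<close>.
\<close>

lemma scaleR_if_total:
  fixes e y :: "'a::banach_lattice"
  assumes total: "\<And>z :: 'a. 0 \<le> z \<or> z \<le> 0" and e: "0 \<le> e" "e \<noteq> 0"
  shows "\<exists>t. y = t *\<^sub>R e"
proof -
  define S where "S = {t. t *\<^sub>R e \<le> y}"
  have cmp: "a \<le> b \<or> b \<le> a" for a b :: 'a
    using total[of "b - a"] by simp
  have bound: "t * norm e \<le> norm v" if "t *\<^sub>R e \<le> v" "0 \<le> t" for t and v :: 'a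
    using norm_mono_nonneg[of "t *\<^sub>R e" v] that e by (simp add: scaleR_nonneg_nonneg)
  define b where "b = norm y / norm e + 1"
  have b: "norm y < b * norm e" "0 \<le> b"
    using e by (simp_all add: b_def field_simps)
  have down: "s \<in> S" if "t \<in> S" "s \<le> t" for s t
    using that scaleR_right_mono[of s t e] e by (auto simp: S_def)
  have "b \<notin> S"
    using bound[of b y] b by (auto simp: S_def)
  then have above: "t \<le> b" if "t \<in> S" for t
    using down that by (meson linear)
  have "- b \<in> S"
  proof (rule ccontr)
    assume "- b \<notin> S"
    then have "y \<le> (- b) *\<^sub>R e" using cmp by (auto simp: S_def)
    then have "b *\<^sub>R e \<le> - y" by (simp add: le_minus_iff)
    then show False using bound[of b "- y"] b by simp
  qed
  have bdd: "bdd_above S" using above by (auto simp: bdd_above_def)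
  define T where "T = Sup S"
  have "norm (y - T *\<^sub>R e) \<le> \<epsilon> * norm e" if "0 < \<epsilon>" for \<epsilon>
  proof -
    have "S \<noteq> {}" "T - \<epsilon> < Sup S" using \<open>- b \<in> S\<close> that by (auto simp: T_def)
    then obtain t where "t \<in> S" "T - \<epsilon> < t"
      using less_cSupD by blast
    then have lo: "(T - \<epsilon>) *\<^sub>R e \<le> y" using down[of t "T - \<epsilon>"] by (simp add: S_def)
    have "T + \<epsilon> \<notin> S"
      using cSup_upper[OF _ bdd, of "T + \<epsilon>"] that by (auto simp: T_def)
    then have hi: "y \<le> (T + \<epsilon>) *\<^sub>R e" using cmp by (auto simp: S_def)
    have "\<bar>y - T *\<^sub>R e\<bar> \<le> \<epsilon> *\<^sub>R e"
      using lo hi by (intro abs_leI) (simp_all add: algebra_simps)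
    also have "\<dots> = \<bar>\<epsilon> *\<^sub>R e\<bar>"
      using that e by (simp add: scaleR_nonneg_nonneg)
    finally show ?thesis
      using norm_mono_abs that by fastforce
  qed
  note small = this
  have "norm (y - T *\<^sub>R e) \<le> 0"
  proof (rule field_le_epsilon)
    fix d :: real assume "0 < d"
    then show "norm (y - T *\<^sub>R e) \<le> 0 + d"
      using small[of "d / norm e"] e by simp
  qed
  then show ?thesis by (metis norm_le_zero_iff right_minus_eq)
qed

text \<open>
  An element \<open>z\<close> comparable with \<open>0\<close> in neither direction has nonzero disjoint parts
  \<open>pprt z\<close> and \<open>pprt (- z)\<close>, which are then normalised. Without such an element the order is
  total, and two independent vectors would be multiples of one.
\<close>

lemma ex_disjoint_pos_sphere:
  assumes "dim_ge_two TYPE('a::banach_lattice)"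
  shows "\<exists>x y :: 'a. x \<in> pos_sphere \<and> y \<in> pos_sphere \<and> inf x y = 0"
proof (cases "\<forall>z :: 'a. 0 \<le> z \<or> z \<le> 0")
  case True
  obtain B :: "'a set" where "card B = 2" and ind: "independent B"
    using assms by (auto simp: dim_ge_two_def)
  then obtain a b where ab: "B = {a, b}" "a \<noteq> b" by (auto simp: card_2_iff)
  have a: "a \<noteq> 0" using ind ab dependent_zero by blast
  then obtain t s where ts: "b = t *\<^sub>R \<bar>a\<bar>" "a = s *\<^sub>R \<bar>a\<bar>"
    using scaleR_if_total[of "\<bar>a\<bar>"] True by (metis abs_ge_zero abs_0_eq)
  then have "s \<noteq> 0" using a by auto
  then have "b = (t / s) *\<^sub>R a"
    by (subst ts(1), subst (2) ts(2)) simp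
  then have "b \<in> span {a}" by (metis insertI1 span_base span_scale)
  moreover have "b \<notin> span {a}"
    using ind ab by (metis dependent_insertD independent_insert insert_commute singletonD)
  ultimately show ?thesis by blast
next
  case False
  then obtain z :: 'a where z: "\<not> 0 \<le> z" "\<not> z \<le> 0" by blast
  let ?n = "\<lambda>v :: 'a. (1 / norm v) *\<^sub>R v"
  have "pprt z \<noteq> 0" "pprt (- z) \<noteq> 0"
    using z unfolding pprt_def by (metis sup_ge1, metis neg_le_0_iff_le sup_ge1)
  then have "?n (pprt z) \<in> pos_sphere" "?n (pprt (- z)) \<in> pos_sphere"
    by (auto simp: pos_sphere_def intro!: scaleR_nonneg_nonneg)
  moreover have "inf (?n (pprt z)) (?n (pprt (- z))) = 0"
    by (intro inf_scaleR_eq_0 inf_pprt_pprt_uminus) auto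
  ultimately show ?thesis by blast
qed

section \<open>The equivalence\<close>

theorem theorem5p1:
  assumes "dim_ge_two TYPE('a::banach_lattice)"
  shows "(lattice_schaffer TYPE('a) = 2 \<longleftrightarrow> lattice_beta TYPE('a) = 2) \<and>
         (lattice_beta TYPE('a) = 2 \<longleftrightarrow> abstract_L_space TYPE('a))"
proof -
  let ?S = "{max (norm (x - y)) (norm (x + y)) | x y :: 'a. x \<in> pos_sphere \<and> y \<in> pos_sphere}"
  let ?B = "{norm (sup x y) | x y :: 'a. x \<in> pos_sphere \<and> y \<in> pos_sphere \<and> inf x y = 0}"
  obtain p q :: 'a where pq: "p \<in> pos_sphere" "q \<in> pos_sphere" "inf p q = 0"
    using ex_disjoint_pos_sphere[OF assms] by blast
  have max_eq: "max (norm (x - y)) (norm (x + y)) = norm (x + y)"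
    if "x \<in> pos_sphere" "y \<in> pos_sphere" for x y :: 'a
    using norm_diff_le_norm_add[of x y] that by (simp add: pos_sphere_def)
  have two: "norm (x + y) = 2"
    if "abstract_L_space TYPE('a)" "x \<in> pos_sphere" "y \<in> pos_sphere" for x y :: 'a
    using norm_add_nonneg[OF that(1)] that by (simp add: pos_sphere_def)
  have "abstract_L_space TYPE('a)" if "lattice_schaffer TYPE('a) = 2"
  proof (rule abstract_L_space_if_pos_sphere)
    fix x y :: 'a assume xy: "x \<in> pos_sphere" "y \<in> pos_sphere"
    have "Inf ?S \<le> norm (x + y)"
      using xy max_eq[OF xy] by (intro cInf_lower) (force, auto intro!: bdd_belowI[of _ 0] simp: le_max_iff_disj)
    then show "2 \<le> norm (x + y)" using that by (simp add: lattice_schaffer_def)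
  qed
  moreover have "abstract_L_space TYPE('a)" if "lattice_beta TYPE('a) = 2"
  proof (rule abstract_L_space_if_pos_sphere)
    fix x y :: 'a assume xy: "x \<in> pos_sphere" "y \<in> pos_sphere" "inf x y = 0"
    have "Inf ?B \<le> norm (sup x y)"
      using xy by (intro cInf_lower) (force, auto intro!: bdd_belowI[of _ 0])
    then show "2 \<le> norm (x + y)"
      using that by (simp add: lattice_beta_def sup_eq_add_if_disjoint[OF xy(3)])
  qed
  moreover have "lattice_schaffer TYPE('a) = 2" if "abstract_L_space TYPE('a)"
  proof -
    have "?S = {2}"
      using max_eq two[OF that] pq by (auto, metis)
    then show ?thesis by (simp add: lattice_schaffer_def)
  qed
  moreover have "lattice_beta TYPE('a) = 2" if "abstract_L_space TYPE('a)"
  proof -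
    have "?B = {2}"
      using two[OF that] pq by (auto simp: sup_eq_add_if_disjoint) (metis sup_eq_add_if_disjoint)
    then show ?thesis by (simp add: lattice_beta_def)
  qed
  ultimately show ?thesis by blast
qed

end
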